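(* Let $X$ be a finite $T_0$-space and let $a\in\mathrm{mxl}(X)$ be a down beat point of $X$. Let $b=\max \widehat U_a$. (a) If $b\notin\mathrm{mxl}(X-\{a\})$, then $U_a$ is a down beat point of $\mathcal{U}(X)$ and $\mathcal{U}(X-\{a\})$ is a ubp-retract of $\mathcal{U}(X)-\{U_a\}$. (b) If $b\in\mathrm{mxl}(X-\{a\})$, then $\mathcal{U}(X)$ and $\mathcal{U}(X-\{a\})$ are homeomorphic.
   Context: A finite $T_0$-space is identified with a finite poset: $x\le y$ iff $U_x\subseteq U_y$, where $U_x=\{z\mid z\le x\}$ is the minimal open set containing $x$. Open sets are the down-sets, and continuous maps are the order-preserving maps. Let $\widehat U_x=U_x-\{x\}$ and $\widehat F_x=\{z\mid z>x\}$. A point $x\in X$ is a down beat point of $X$ if $\widehat U_x$ has a maximum, and an up beat point of $X$ if $\widehat F_x$ has a minimum. A subspace $A\subseteq X$ is a ubp-retract of $X$ if $A$ can be obtained from $X$ by successively removing up beat points, one at a time, each being an up beat point of the subspace obtained at that stage (zero removals allowed). $\mathrm{mxl}(X)$ is the set of maximal elements of $X$. For a non-empty subset $B\subseteq X$ let $U_B=\bigcap_{b\in B}U_b$. $\mathcal{U}(X)$ is the set of all connected components of the non-empty sets $U_B$ with $\varnothing\ne B\subseteq \mathrm{mxl}(X)$, regarded as a poset (finite $T_0$-space) ordered by $\subseteq$. (For $a\in \mathrm{mxl}(X)$, $U_a\in\mathcal{U}(X)$.) Elements of $\mathcal{U}(X-\{a\})$ are subsets of $X-\{a\}\subseteq X$,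 and in (a) $\mathcal{U}(X-\{a\})$ is regarded as a subset of $\mathcal{U}(X)-\{U_a\}$ in this way. *)

theory Defs
  imports "HOL-Analysis.Analysis"
begin

text \<open>
  Finite \<open>T\<^sub>0\<close>-spaces are abstract topologies \<open>X\<close> with \<open>finite (topspace X)\<close> and \<open>t0_space X\<close>.
  The set \<open>min_open X x\<close> is the minimal open set \<open>U\<^sub>x\<close>; it is only meaningful for
  \<open>x \<in> topspace X\<close>.
\<close>

definition min_open :: "'a topology \<Rightarrow> 'a \<Rightarrow> 'a set" where
  "min_open X x = \<Inter>{V. openin X V \<and> x \<in> V}"

definition space_le :: "'a topology \<Rightarrow> 'a \<Rightarrow> 'a \<Rightarrow> bool" where
  "space_le X x y \<longleftrightarrow> x \<in> topspace X \<and> y \<in> topspace X \<and> min_open X x \<subseteq> min_open X y"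

definition is_maximum :: "'a topology \<Rightarrow> 'a set \<Rightarrow> 'a \<Rightarrow> bool" where
  "is_maximum X S m \<longleftrightarrow> m \<in> S \<and> (\<forall>z\<in>S. space_le X z m)"

definition is_minimum :: "'a topology \<Rightarrow> 'a set \<Rightarrow> 'a \<Rightarrow> bool" where
  "is_minimum X S m \<longleftrightarrow> m \<in> S \<and> (\<forall>z\<in>S. space_le X m z)"

definition U_hat :: "'a topology \<Rightarrow> 'a \<Rightarrow> 'a set" where
  "U_hat X x = min_open X x - {x}"

definition F_hat :: "'a topology \<Rightarrow> 'a \<Rightarrow> 'a set" where
  "F_hat X x = {z. space_le X x z \<and> z \<noteq> x}"

definition down_beat_point :: "'a topology \<Rightarrow> 'a \<Rightarrow> bool" where
  "down_beat_point X x \<longleftrightarrow> x \<in> topspace X \<and> (\<exists>m. is_maximum X (U_hat X x) m)"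

definition up_beat_point :: "'a topology \<Rightarrow> 'a \<Rightarrow> bool" where
  "up_beat_point X x \<longleftrightarrow> x \<in> topspace X \<and> (\<exists>m. is_minimum X (F_hat X x) m)"

definition remove_point :: "'a topology \<Rightarrow> 'a \<Rightarrow> 'a topology" where
  "remove_point X x = subtopology X (topspace X - {x})"

text \<open>\<open>ubp_retract X A\<close>: the space \<open>A\<close>, with its topology, is a ubp-retract of \<open>X\<close>.\<close>

inductive ubp_retract :: "'a topology \<Rightarrow> 'a topology \<Rightarrow> bool" for X where
  refl: "ubp_retract X X"
| step: "ubp_retract X Y \<Longrightarrow> up_beat_point Y x \<Longrightarrow> ubp_retract X (remove_point Y x)"

definition mxl :: "'a topology \<Rightarrow> 'a set" where
  "mxl X = {x \<in> topspace X. \<forall>y. space_le X x y \<longrightarrow> y = x}"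

definition U_Inter :: "'a topology \<Rightarrow> 'a set \<Rightarrow> 'a set" where
  "U_Inter X B = (\<Inter>b\<in>B. min_open X b)"

definition mxl_components :: "'a topology \<Rightarrow> 'a set set" where
  "mxl_components X =
     {C. \<exists>B. B \<noteq> {} \<and> B \<subseteq> mxl X \<and> U_Inter X B \<noteq> {} \<and>
             C \<in> connected_components_of (subtopology X (U_Inter X B))}"

text \<open>The space associated with a poset: its open sets are the down-sets.\<close>

definition down_set_topology :: "'a::order set \<Rightarrow> 'a topology" where
  "down_set_topology P = topology (\<lambda>D. D \<subseteq> P \<and> (\<forall>y\<in>D. \<forall>x\<in>P. x \<le> y \<longrightarrow> x \<in> D))"

text \<open>For sets, the order \<open>\<le>\<close> of class \<open>order\<close> is inclusion.\<close>

definition U_space :: "'a topology \<Rightarrow> 'a set topology" where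
  "U_space X = down_set_topology (mxl_components X)"

lemma openin_down_set_topology:
  "openin (down_set_topology P) D \<longleftrightarrow> D \<subseteq> P \<and> (\<forall>y\<in>D. \<forall>x\<in>P. x \<le> y \<longrightarrow> x \<in> D)"
proof -
  have "istopology (\<lambda>D. D \<subseteq> P \<and> (\<forall>y\<in>D. \<forall>x\<in>P. x \<le> y \<longrightarrow> x \<in> D))"
    unfolding istopology_def by blast
  then show ?thesis
    by (simp add: down_set_topology_def topology_inverse')
qed

lemma topspace_down_set_topology [simp]: "topspace (down_set_topology P) = P"
  unfolding topspace_def openin_down_set_topology by blast

lemma topspace_U_space [simp]: "topspace (U_space X) = mxl_components X"
  by (simp add: U_space_def)

lemma min_open_down_set_topology:
  assumes "x \<in> P"
  shows "min_open (down_set_topology P) x = {z \<in> P. z \<le> x}"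
proof
  have "openin (down_set_topology P) {z \<in> P. z \<le> x}"
    by (auto simp: openin_down_set_topology)
  then show "min_open (down_set_topology P) x \<subseteq> {z \<in> P. z \<le> x}"
    using assms unfolding min_open_def by blast
  show "{z \<in> P. z \<le> x} \<subseteq> min_open (down_set_topology P) x"
    unfolding min_open_def openin_down_set_topology by blast
qed

lemma space_le_down_set_topology:
  "space_le (down_set_topology P) x y \<longleftrightarrow> x \<in> P \<and> y \<in> P \<and> x \<le> y"
  by (auto simp: space_le_def min_open_down_set_topology intro: order_trans)

lemma openin_min_open:
  assumes "finite (topspace X)" "x \<in> topspace X"
  shows "openin X (min_open X x)"
  unfolding min_open_def
proof (rule openin_Inter)
  have "{V. openin X V \<and> x \<in> V} \<subseteq> Pow (topspace X)"
    using openin_subset by blast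
  then show "finite {V. openin X V \<and> x \<in> V}"
    using assms(1) by (meson finite_Pow_iff finite_subset)
  show "{V. openin X V \<and> x \<in> V} \<noteq> {}"
    using assms(2) by blast
qed auto

lemma min_open_eq:
  assumes "x \<in> topspace X"
  shows "min_open X x = {z. space_le X z x}"
proof -
  have "min_open X x \<subseteq> topspace X"
    using assms unfolding min_open_def by blast
  then show ?thesis
    using assms unfolding space_le_def min_open_def by blast
qed

end

theory Submission
  imports Defs
begin

text \<open>
  Write \<open>Y\<close> for \<open>X - {a}\<close>. Since \<open>a\<close> is maximal, \<open>U\<^sub>y\<close> is the same set in \<open>X\<close> and
  in \<open>Y\<close> for every \<open>y \<noteq> a\<close>, and since \<open>b\<close> is the maximum below \<open>a\<close>, the set \<open>U\<^sub>a\<close> is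
  \<open>U\<^sub>b\<close> with \<open>a\<close> added. Hence in an intersection \<open>U\<^sub>B\<close> that involves a
  point other than \<open>a\<close>, the point \<open>a\<close> of \<open>B\<close> may be exchanged for \<open>b\<close>
  (\<open>U_Inter_insert_a\<close>). Such an intersection does not contain \<open>a\<close>, so \<open>U\<^sub>a\<close> is the
  only element of \<open>U_space X\<close> that does.

  Suppose that \<open>b\<close> is not maximal in \<open>Y\<close>. Then \<open>Y\<close> has no maximal points
  other than those of \<open>X\<close>, and some of them, say \<open>c\<close>, lies above \<open>b\<close>. Therefore
  \<open>U\<^sub>b = U\<^sub>a \<inter> U\<^sub>c\<close> is an element of \<open>U_space X\<close>, and it is the largest one properly
  inside \<open>U\<^sub>a\<close>. For the retract, every element \<open>C \<noteq> U\<^sub>a\<close> of \<open>U_space X\<close> has a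
  least element of \<open>U_space Y\<close> above it (\<open>exists_minimum_above_in_Y\<close>), and in a finite poset
  this allows removing the elements outside \<open>U_space Y\<close> one by one from the top, each
  being an up beat point at its turn (\<open>ubp_retract_down_set_topology\<close>).

  Suppose that \<open>b\<close> is maximal in \<open>Y\<close>. Then \<open>b\<close> lies below no maximal point of \<open>X\<close>
  other than \<open>a\<close>, so that \<open>U_space X\<close> and \<open>U_space Y\<close> differ only in that \<open>U\<^sub>a\<close> is replaced by
  \<open>U\<^sub>b\<close>. Deleting \<open>a\<close> is an order isomorphism, because an element of either poset
  that contains \<open>b\<close> is \<open>U\<^sub>a\<close> or \<open>U\<^sub>b\<close>, respectively.
\<close>

section \<open>The order of a finite space and of its subspaces\<close>

lemma mem_min_open_iff: "y \<in> topspace X \<Longrightarrow> x \<in> min_open X y \<longleftrightarrow> space_le X x y"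
  by (simp add: min_open_eq)

lemma space_le_refl: "x \<in> topspace X \<Longrightarrow> space_le X x x"
  by (simp add: space_le_def)

lemma min_open_subset_topspace: "y \<in> topspace X \<Longrightarrow> min_open X y \<subseteq> topspace X"
  by (auto simp: mem_min_open_iff space_le_def)

lemma space_le_trans: "space_le X x y \<Longrightarrow> space_le X y z \<Longrightarrow> space_le X x z"
  by (auto simp: space_le_def)

lemma space_le_antisym:
  assumes "t0_space X" "space_le X x y" "space_le X y x"
  shows "x = y"
proof (rule ccontr)
  assume "x \<noteq> y"
  moreover have "x \<in> topspace X" "y \<in> topspace X"
    using assms(2) by (auto simp: space_le_def)
  ultimately obtain U where "openin X U" "x \<notin> U \<longleftrightarrow> y \<in> U"
    using assms(1) unfolding t0_space_def by meson
  moreover have "min_open X x = min_open X y"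
    using assms by (auto simp: space_le_def)
  moreover have "x \<in> min_open X x" "y \<in> min_open X y"
    using assms by (auto simp: mem_min_open_iff space_le_def)
  ultimately show False
    unfolding min_open_def by blast
qed

lemma min_open_remove_point:
  assumes "y \<in> topspace X" "y \<noteq> x"
  shows "min_open (remove_point X x) y = min_open X y - {x}"
proof -
  have "{V. openin (remove_point X x) V \<and> y \<in> V} =
        (\<lambda>V. V \<inter> (topspace X - {x})) ` {V. openin X V \<and> y \<in> V}"
    using assms by (auto simp: remove_point_def openin_subtopology)
  moreover have "openin X (topspace X)" by simp
  ultimately show ?thesis
    unfolding min_open_def using assms by auto
qed

lemma topspace_remove_point [simp]: "topspace (remove_point X x) = topspace X - {x}"
  by (auto simp: remove_point_def)

lemma space_le_remove_point:
  "space_le (remove_point X a) x y \<longleftrightarrow> x \<noteq> a \<and> y \<noteq> a \<and> space_le X x y"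
proof (cases "y \<in> topspace X - {a}")
  case True
  then have "space_le (remove_point X a) x y \<longleftrightarrow> x \<in> min_open (remove_point X a) y"
    by (subst mem_min_open_iff) auto
  with True show ?thesis
    by (auto simp: min_open_remove_point mem_min_open_iff)
qed (auto simp: space_le_def)

lemma mxlD: "c \<in> mxl X \<Longrightarrow> space_le X c y \<Longrightarrow> y = c"
  by (auto simp: mxl_def)

text \<open>
  A point above \<open>x\<close> whose minimal open set is largest under inclusion is maximal.
\<close>

lemma exists_mxl_above:
  assumes "finite (topspace X)" "t0_space X" "x \<in> topspace X"
  shows "\<exists>d\<in>mxl X. space_le X x d"
proof -
  let ?M = "min_open X ` {y. space_le X x y}"
  have "finite {y. space_le X x y}"
    by (rule finite_subset[OF _ assms(1)]) (auto simp: space_le_def)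
  then have "finite ?M" by simp
  moreover have "?M \<noteq> {}" using assms(3) space_le_refl by fastforce
  ultimately obtain d where d: "space_le X x d"
      and max: "\<And>y. space_le X x y \<Longrightarrow> min_open X d \<subseteq> min_open X y \<Longrightarrow> min_open X d = min_open X y"
    using finite_has_maximal[of ?M] by blast
  have "y = d" if "space_le X d y" for y
    using max[of y] that d space_le_trans[OF d that] space_le_antisym[OF assms(2), of y d]
    by (auto simp: space_le_def)
  with d show ?thesis by (auto simp: mxl_def space_le_def)
qed

text \<open>
  An open set that contains \<open>x\<close> contains all of \<open>U\<^sub>x\<close>, so \<open>U\<^sub>x\<close> cannot be split
  by two open sets.
\<close>

lemma connectedin_min_open:
  assumes "x \<in> topspace X"
  shows "connectedin X (min_open X x)"
proof -
  have sub: "min_open X x \<subseteq> E" if "openin X E" "x \<in> E" for E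
    using that by (auto simp: min_open_def)
  have x: "x \<in> min_open X x"
    using assms by (simp add: mem_min_open_iff space_le_refl)
  show ?thesis
    unfolding connectedin
  proof (intro conjI notI min_open_subset_topspace assms, elim exE conjE)
    fix E1 E2
    assume E: "openin X E1" "openin X E2" "min_open X x \<subseteq> E1 \<union> E2"
      and disj: "E1 \<inter> E2 \<inter> min_open X x = {}"
        "E1 \<inter> min_open X x \<noteq> {}" "E2 \<inter> min_open X x \<noteq> {}"
    have "min_open X x \<subseteq> E1 \<or> min_open X x \<subseteq> E2"
      using x E(3) sub[OF E(1)] sub[OF E(2)] by auto
    with disj show False by blast
  qed
qed

section \<open>Components of intersections of minimal open sets\<close>

text \<open>
  The subspace disappears from the right-hand side except through \<open>S\<close>. This is the form
  that makes components of \<open>S\<close> comparable for different \<open>S\<close> and for different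
  ambient spaces.
\<close>

lemma connected_components_of_subtopology_iff:
  "C \<in> connected_components_of (subtopology X S) \<longleftrightarrow>
     C \<noteq> {} \<and> connectedin X C \<and> C \<subseteq> S \<and>
     (\<forall>D. connectedin X D \<and> D \<subseteq> S \<and> D \<inter> C \<noteq> {} \<longrightarrow> D \<subseteq> C)" (is "?L \<longleftrightarrow> ?R")
proof
  assume L: ?L
  then have "connectedin (subtopology X S) C" "C \<noteq> {}"
    by (auto intro: connectedin_connected_components_of dest: nonempty_connected_components_of)
  with L show ?R
    using connected_components_of_maximal[OF L]
    by (auto simp: connectedin_subtopology disjnt_def Int_commute)
next
  assume R: ?R
  then have "connectedin (subtopology X S) C"
    by (simp add: connectedin_subtopology)
  moreover from this R have "subtopology X S \<noteq> trivial_topology"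
    using connectedin_subset_topspace by fastforce
  ultimately obtain E where E: "E \<in> connected_components_of (subtopology X S)" "C \<subseteq> E"
    using exists_connected_component_of_superset by blast
  then have "connectedin X E" "E \<subseteq> S"
    using connectedin_connected_components_of[OF E(1)] by (auto simp: connectedin_subtopology)
  with R E have "E = C" by blast
  with E show ?L by simp
qed

lemma exists_component_containing:
  assumes "connectedin X C" "C \<noteq> {}" "C \<subseteq> S"
  shows "\<exists>D\<in>connected_components_of (subtopology X S). C \<subseteq> D"
proof -
  have "connectedin (subtopology X S) C"
    using assms by (simp add: connectedin_subtopology)
  moreover from this assms have "subtopology X S \<noteq> trivial_topology"
    using connectedin_subset_topspace by fastforce
  ultimately show ?thesis
    using exists_connected_component_of_superset by blast
qed

lemma mxl_components_iff:
  "C \<in> mxl_components X \<longleftrightarrow>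
     (\<exists>B. B \<noteq> {} \<and> B \<subseteq> mxl X \<and> C \<in> connected_components_of (subtopology X (U_Inter X B)))"
proof -
  have ne: "S \<noteq> {}" if "C \<in> connected_components_of (subtopology X S)" for S
    using that by (auto simp: connected_components_of_subtopology_iff)
  then show ?thesis
    unfolding mxl_components_def mem_Collect_eq by (intro ex_cong1) (metis ne)
qed

lemma U_Inter_singleton [simp]: "U_Inter X {x} = min_open X x"
  by (simp add: U_Inter_def)

lemma component_of_min_open_iff:
  assumes "x \<in> topspace X"
  shows "C \<in> connected_components_of (subtopology X (min_open X x)) \<longleftrightarrow> C = min_open X x"
proof -
  have "min_open X x \<noteq> {}"
    using assms space_le_refl by (fastforce simp: min_open_eq)
  then show ?thesis
    using connectedin_min_open[OF assms] unfolding connected_components_of_subtopology_iff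
    by blast
qed

lemma min_open_in_mxl_components: "x \<in> mxl X \<Longrightarrow> min_open X x \<in> mxl_components X"
  unfolding mxl_components_iff
  by (rule exI[of _ "{x}"]) (auto simp: mxl_def component_of_min_open_iff)

lemma finite_mxl_components:
  assumes "finite (topspace X)"
  shows "finite (mxl_components X)"
proof (rule finite_subset)
  show "mxl_components X \<subseteq> Pow (topspace X)"
    using connectedin_subset_topspace
    by (fastforce simp: mxl_components_iff connected_components_of_subtopology_iff)
qed (use assms in simp)

section \<open>Posets as finite spaces\<close>

text \<open>
  A down-set of the smaller poset is the trace of the down-set that it generates in the whole poset.
\<close>

lemma remove_point_down_set_topology:
  "remove_point (down_set_topology P) x = down_set_topology (P - {x})"
proof (rule topology_eq[THEN iffD2, rule_format])
  fix D
  show "openin (remove_point (down_set_topology P) x) D \<longleftrightarrow> openin (down_set_topology (P - {x})) D"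
  proof
    assume D: "openin (down_set_topology (P - {x})) D"
    let ?E = "{z\<in>P. \<exists>y\<in>D. z \<le> y}"
    have "openin (down_set_topology P) ?E"
      by (auto simp: openin_down_set_topology intro: order_trans)
    moreover have "D = ?E \<inter> (P - {x})"
      using D by (auto simp: openin_down_set_topology)
    ultimately show "openin (remove_point (down_set_topology P) x) D"
      by (auto simp: remove_point_def openin_subtopology)
  qed (auto simp: remove_point_def openin_subtopology openin_down_set_topology)
qed

text \<open>
  Remove the elements of \<open>P - A\<close> in an order that proceeds from the top downwards. When
  the turn of \<open>x\<close> comes, everything left above \<open>x\<close> belongs to \<open>A\<close>, so the least
  element of \<open>A\<close> above \<open>x\<close> makes \<open>x\<close> an up beat point. Since \<open>ubp_retract\<close> adds
  its removals at the end, the induction singles out the last element removed, which is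
  minimal in \<open>P - A\<close>.
\<close>

lemma ubp_retract_down_set_topology:
  fixes A P :: "'a::order set"
  assumes "finite P" "A \<subseteq> P"
    and "\<And>x. x \<in> P - A \<Longrightarrow> \<exists>m\<in>A. x \<le> m \<and> (\<forall>z\<in>A. x \<le> z \<longrightarrow> m \<le> z)"
  shows "ubp_retract (down_set_topology P) (down_set_topology A)"
  using assms(2,3)
proof (induction "card (P - A)" arbitrary: A)
  case 0
  then have "A = P" using assms(1) by auto
  then show ?case by (simp add: ubp_retract.refl)
next
  case (Suc n)
  then have "P - A \<noteq> {}" by (metis card.empty nat.distinct(1))
  then obtain x where x: "x \<in> P - A" and min: "\<And>y. y \<in> P - A \<Longrightarrow> y \<le> x \<Longrightarrow> y = x"
    using finite_has_minimal[of "P - A"] assms(1) by blast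
  have "P - insert x A = P - A - {x}" by auto
  then have "n = card (P - insert x A)"
    using Suc.hyps(2) x assms(1) by simp
  moreover have "\<exists>m\<in>insert x A. y \<le> m \<and> (\<forall>z\<in>insert x A. y \<le> z \<longrightarrow> m \<le> z)"
    if y: "y \<in> P - insert x A" for y
  proof -
    \<comment> \<open>Minimality of \<open>x\<close> keeps \<open>x\<close> out of the elements above \<open>y\<close>.\<close>
    have "\<not> y \<le> x" using min[of y] y by auto
    then show ?thesis using Suc.prems(2)[of y] y by auto
  qed
  ultimately have "ubp_retract (down_set_topology P) (down_set_topology (insert x A))"
    using Suc.prems(1) x by (intro Suc.hyps(1)) auto
  moreover have "up_beat_point (down_set_topology (insert x A)) x"
  proof -
    obtain m where "m \<in> A" "x \<le> m" "\<And>z. z \<in> A \<Longrightarrow> x \<le> z \<Longrightarrow> m \<le> z"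
      using Suc.prems(2)[OF x] by blast
    then have "is_minimum (down_set_topology (insert x A)) (F_hat (down_set_topology (insert x A)) x) m"
      using x by (auto simp: is_minimum_def F_hat_def space_le_down_set_topology)
    then show ?thesis by (auto simp: up_beat_point_def)
  qed
  ultimately have "ubp_retract (down_set_topology P)
      (remove_point (down_set_topology (insert x A)) x)"
    by (rule ubp_retract.step)
  then show ?case
    using x by (simp add: remove_point_down_set_topology)
qed

lemma homeomorphic_down_set_topology:
  fixes P :: "'a::order set" and Q :: "'b::order set"
  assumes "\<And>x. x \<in> P \<Longrightarrow> f x \<in> Q" "\<And>y. y \<in> Q \<Longrightarrow> g y \<in> P"
    and "\<And>x. x \<in> P \<Longrightarrow> g (f x) = x" "\<And>y. y \<in> Q \<Longrightarrow> f (g y) = y"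
    and "mono_on P f" "mono_on Q g"
  shows "down_set_topology P homeomorphic_space down_set_topology Q"
proof -
  have cont: "continuous_map (down_set_topology P') (down_set_topology Q') h"
    if "\<And>x. x \<in> P' \<Longrightarrow> h x \<in> Q'" "mono_on P' h"
    for P' :: "'c::order set" and Q' :: "'d::order set" and h
    using that by (auto simp: continuous_map openin_down_set_topology mono_on_def)
  have "homeomorphic_maps (down_set_topology P) (down_set_topology Q) f g"
    unfolding homeomorphic_maps_def using assms by (simp add: cont)
  then show ?thesis
    unfolding homeomorphic_space_def by blast
qed

section \<open>Removing a maximal down beat point\<close>

locale maximal_down_beat_point =
  fixes X :: "'a topology" and a b :: 'a
  assumes finite_X: "finite (topspace X)"
    and t0_X: "t0_space X"
    and a_mxl: "a \<in> mxl X"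
    and b_maximum: "is_maximum X (U_hat X a) b"
begin

abbreviation Y :: "'a topology" where
  "Y \<equiv> remove_point X a"

lemma a_in_X: "a \<in> topspace X"
  using a_mxl by (simp add: mxl_def)

lemma below_a: "space_le X z a \<Longrightarrow> z \<noteq> a \<Longrightarrow> space_le X z b"
  using b_maximum a_in_X by (auto simp: is_maximum_def U_hat_def mem_min_open_iff)

lemma b_le_a: "space_le X b a" and b_neq_a: "b \<noteq> a"
  using b_maximum a_in_X by (auto simp: is_maximum_def U_hat_def mem_min_open_iff)

lemma b_in_X: "b \<in> topspace X"
  using b_le_a by (simp add: space_le_def)

lemma a_in_min_open_iff: "c \<in> topspace X \<Longrightarrow> a \<in> min_open X c \<longleftrightarrow> c = a"
  using mxlD[OF a_mxl] a_in_X by (auto simp: mem_min_open_iff space_le_refl)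

lemma min_open_a: "min_open X a = insert a (min_open X b)"
  using below_a b_le_a a_in_X b_in_X by (auto simp: min_open_eq space_le_refl intro: space_le_trans)

lemma min_open_Y: "y \<in> topspace X \<Longrightarrow> y \<noteq> a \<Longrightarrow> min_open Y y = min_open X y"
  by (simp add: min_open_remove_point a_in_min_open_iff)

text \<open>
  The sets \<open>U\<^sub>a\<close> and \<open>U\<^sub>b\<close> differ only in \<open>a\<close>, which lies in no \<open>U\<^sub>c\<close> with \<open>c \<noteq> a\<close>.
\<close>

lemma U_Inter_insert_a:
  assumes "B \<noteq> {}" "B \<subseteq> topspace X - {a}"
  shows "U_Inter X (insert a B) = U_Inter X (insert b B)"
proof -
  have "a \<notin> U_Inter X B"
    using assms a_in_min_open_iff by (fastforce simp: U_Inter_def)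
  then show ?thesis
    by (auto simp: U_Inter_def min_open_a)
qed

lemma mxl_subset_X: "mxl X \<subseteq> topspace X" and mxl_Y_subset: "mxl Y \<subseteq> topspace X - {a}"
  by (auto simp: mxl_def)

lemma mxl_Y_I: "c \<in> mxl X \<Longrightarrow> c \<noteq> a \<Longrightarrow> c \<in> mxl Y"
  by (auto simp: mxl_def space_le_remove_point)

text \<open>
  A point that becomes maximal only by the removal of \<open>a\<close> lies below \<open>a\<close>, hence below \<open>b\<close>,
  and its maximality in \<open>Y\<close> forces it to be \<open>b\<close>.
\<close>

lemma mxl_Y_D:
  assumes "c \<in> mxl Y" "c \<noteq> b"
  shows "c \<in> mxl X - {a}"
proof -
  have "y = c" if "space_le X c y" for y
  proof (cases "y = a")
    case True
    then have "space_le X c b"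
      using below_a that assms(1) mxl_Y_subset by blast
    then have "space_le Y c b"
      using b_neq_a assms(1) mxl_Y_subset by (auto simp: space_le_remove_point)
    then show ?thesis using mxlD[OF assms(1)] assms(2) by blast
  next
    case False
    then have "space_le Y c y"
      using that assms(1) mxl_Y_subset by (auto simp: space_le_remove_point)
    then show ?thesis using mxlD[OF assms(1)] by blast
  qed
  then show ?thesis
    using assms(1) mxl_Y_subset by (auto simp: mxl_def)
qed

text \<open>
  No \<open>U\<^sub>c\<close> with \<open>c \<noteq> a\<close> contains \<open>a\<close>. Hence components for \<open>Y\<close> can be computed inside
  \<open>X\<close>, and only the supply of maximal points changes.
\<close>

lemma mxl_components_Y_iff:
  "C \<in> mxl_components Y \<longleftrightarrow>
     (\<exists>B. B \<noteq> {} \<and> B \<subseteq> mxl Y \<and> C \<in> connected_components_of (subtopology X (U_Inter X B)))"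
proof -
  have "subtopology Y (U_Inter Y B) = subtopology X (U_Inter X B)"
    if B: "B \<noteq> {}" "B \<subseteq> mxl Y" for B
  proof -
    have B': "b' \<in> topspace X" "b' \<noteq> a" if "b' \<in> B" for b'
      using that B mxl_Y_subset by auto
    have "U_Inter Y B = U_Inter X B"
      using B' by (simp add: U_Inter_def min_open_Y)
    moreover have "U_Inter X B \<subseteq> topspace X - {a}"
      using B B' a_in_min_open_iff min_open_subset_topspace
      by (fastforce simp: U_Inter_def)
    ultimately show ?thesis
      by (simp add: remove_point_def subtopology_subtopology inf_absorb2)
  qed
  then show ?thesis
    unfolding mxl_components_iff by metis
qed

text \<open>
  If \<open>a \<in> U\<^sub>B\<close>, then \<open>B = {a}\<close> by maximality of \<open>a\<close>, and \<open>U\<^sub>a\<close> is connected.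
\<close>

lemma mxl_component_avoids_a:
  assumes "C \<in> mxl_components X" "C \<noteq> min_open X a"
  shows "a \<notin> C"
proof
  assume "a \<in> C"
  obtain B where B: "B \<noteq> {}" "B \<subseteq> mxl X"
      and C: "C \<in> connected_components_of (subtopology X (U_Inter X B))"
    using assms(1) by (auto simp: mxl_components_iff)
  have "C \<subseteq> U_Inter X B"
    using C by (simp add: connected_components_of_subtopology_iff)
  then have "c = a" if "c \<in> B" for c
    using that \<open>a \<in> C\<close> B(2) mxl_subset_X a_in_min_open_iff[of c] by (auto simp: U_Inter_def)
  then have "B = {a}"
    using B(1) by blast
  then show False
    using C assms(2) a_in_X by (simp add: component_of_min_open_iff)
qed

lemma min_open_a_in: "min_open X a \<in> mxl_components X"
  by (rule min_open_in_mxl_components[OF a_mxl])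

lemma a_in_min_open_a: "a \<in> min_open X a"
  by (simp add: min_open_a)

lemma b_in_min_open_b: "b \<in> min_open X b"
  using b_in_X by (simp add: mem_min_open_iff space_le_refl)

lemma mxl_component_Y_avoids_a: "C \<in> mxl_components Y \<Longrightarrow> a \<notin> C"
proof -
  assume "C \<in> mxl_components Y"
  then obtain B where B: "B \<noteq> {}" "B \<subseteq> mxl Y" "C \<subseteq> U_Inter X B"
    by (auto simp: mxl_components_Y_iff connected_components_of_subtopology_iff)
  then show "a \<notin> C"
    using mxl_Y_subset a_in_min_open_iff by (fastforce simp: U_Inter_def)
qed

subsection \<open>The case of a non-maximal \<open>b\<close>\<close>

context
  assumes b_not_mxl: "b \<notin> mxl Y"
begin

lemma mxl_Y: "mxl Y = mxl X - {a}"
  using mxl_Y_I mxl_Y_D b_not_mxl by blast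

lemma mxl_components_Y_subset: "mxl_components Y \<subseteq> mxl_components X - {min_open X a}"
proof
  fix C
  assume C: "C \<in> mxl_components Y"
  then have "C \<in> mxl_components X"
    unfolding mxl_components_Y_iff mxl_Y mxl_components_iff[of C X]
    by (meson Diff_subset subset_trans)
  with C show "C \<in> mxl_components X - {min_open X a}"
    using mxl_component_Y_avoids_a a_in_min_open_a by blast
qed

text \<open>
  Take a point \<open>y\<close> of \<open>Y\<close> strictly above \<open>b\<close>. It is not below \<open>a\<close>, since that would
  give \<open>y \<le> b\<close>. So a maximal point above \<open>y\<close> differs from \<open>a\<close>.
\<close>

lemma exists_other_mxl_above_b: "\<exists>c\<in>mxl X - {a}. space_le X b c"
proof -
  obtain y where y: "space_le X b y" "y \<noteq> b" "y \<noteq> a"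
    using b_not_mxl b_in_X b_neq_a by (auto simp: mxl_def space_le_remove_point)
  then obtain c where c: "c \<in> mxl X" "space_le X y c"
    using exists_mxl_above[OF finite_X t0_X, of y] unfolding space_le_def by blast
  have "c \<noteq> a"
    using below_a[of y] space_le_antisym[OF t0_X y(1)] y(2,3) c(2) by blast
  then show ?thesis
    using c(1) space_le_trans[OF y(1) c(2)] by blast
qed

text \<open>
  For a maximal point \<open>c \<noteq> a\<close> above \<open>b\<close>, the intersection \<open>U\<^sub>a \<inter> U\<^sub>c\<close> is \<open>U\<^sub>b\<close>.
\<close>

lemma min_open_b_in: "min_open X b \<in> mxl_components X"
proof -
  obtain c where c: "c \<in> mxl X - {a}" "space_le X b c"
    using exists_other_mxl_above_b by blast
  then have "U_Inter X {a, c} = U_Inter X {b, c}"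
    using mxl_subset_X by (intro U_Inter_insert_a) auto
  also have "\<dots> = min_open X b"
    using c by (auto simp: U_Inter_def space_le_def)
  finally show ?thesis
    using c a_mxl b_in_X unfolding mxl_components_iff
    by (intro exI[of _ "{a, c}"]) (auto simp: component_of_min_open_iff)
qed

lemma down_beat_point_min_open_a: "down_beat_point (U_space X) (min_open X a)"
proof -
  let ?U = "min_open X a"
  have hat: "U_hat (U_space X) ?U = {C \<in> mxl_components X. C \<subset> ?U}"
    using min_open_a_in by (auto simp: U_hat_def U_space_def min_open_down_set_topology)
  have "min_open X b \<subset> ?U"
    using a_in_min_open_iff[OF b_in_X] b_neq_a by (auto simp: min_open_a)
  moreover have "C \<subseteq> min_open X b" if "C \<in> mxl_components X" "C \<subset> ?U" for C
    using mxl_component_avoids_a[of C] that by (auto simp: min_open_a)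
  moreover have "space_le (U_space X) C D \<longleftrightarrow> C \<in> mxl_components X \<and> D \<in> mxl_components X \<and> C \<subseteq> D"
    for C D
    by (simp add: U_space_def space_le_down_set_topology)
  ultimately have "is_maximum (U_space X) (U_hat (U_space X) ?U) (min_open X b)"
    using min_open_b_in by (simp add: hat is_maximum_def)
  then show ?thesis
    using min_open_a_in by (auto simp: down_beat_point_def)
qed

text \<open>
  Let \<open>B\<close> consist of all maximal points of \<open>Y\<close> that bound \<open>C\<close>. The component \<open>D\<close> of
  \<open>U\<^sub>B\<close> around \<open>C\<close> is the required minimum: an element \<open>E\<close> of \<open>U_space Y\<close> containing \<open>C\<close>
  is a component of some \<open>U\<^bsub>B'\<^esub>\<close> with \<open>B' \<subseteq> B\<close>, and so \<open>D\<close> is a connected subset of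
  \<open>U\<^bsub>B'\<^esub>\<close> that meets \<open>E\<close>. The set \<open>B\<close> is non-empty because \<open>C \<noteq> U\<^sub>a\<close>.
\<close>

lemma exists_minimum_above_in_Y:
  assumes "C \<in> mxl_components X" "C \<noteq> min_open X a"
  shows "\<exists>D\<in>mxl_components Y. C \<subseteq> D \<and> (\<forall>E\<in>mxl_components Y. C \<subseteq> E \<longrightarrow> D \<subseteq> E)"
proof -
  obtain B where B: "B \<noteq> {}" "B \<subseteq> mxl X"
      and C: "C \<in> connected_components_of (subtopology X (U_Inter X B))"
    using assms(1) by (auto simp: mxl_components_iff)
  have C': "C \<noteq> {}" "connectedin X C" "C \<subseteq> U_Inter X B"
    using C by (auto simp: connected_components_of_subtopology_iff)
  let ?B = "{c \<in> mxl Y. C \<subseteq> min_open X c}"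
  have "B \<noteq> {a}"
    using C assms(2) a_in_X by (auto simp: component_of_min_open_iff)
  then obtain c where "c \<in> B" "c \<noteq> a"
    using B(1) by blast
  then have "c \<in> ?B"
    using B(2) C'(3) mxl_Y by (auto simp: U_Inter_def)
  then have ne: "?B \<noteq> {}" by blast
  have "C \<subseteq> U_Inter X ?B"
    by (auto simp: U_Inter_def)
  then obtain D where D: "D \<in> connected_components_of (subtopology X (U_Inter X ?B))" "C \<subseteq> D"
    using exists_component_containing[OF C'(2,1)] by blast
  have "D \<in> mxl_components Y"
    unfolding mxl_components_Y_iff using ne D(1) by (intro exI[of _ ?B]) auto
  moreover have "D \<subseteq> E" if E_in: "E \<in> mxl_components Y" and CE: "C \<subseteq> E" for E
  proof -
    obtain B' where B': "B' \<noteq> {}" "B' \<subseteq> mxl Y"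
        and E: "E \<in> connected_components_of (subtopology X (U_Inter X B'))"
      using E_in by (auto simp: mxl_components_Y_iff)
    have "E \<subseteq> U_Inter X B'"
      using E by (simp add: connected_components_of_subtopology_iff)
    then have "B' \<subseteq> ?B"
      using B' CE by (auto simp: U_Inter_def)
    then have "U_Inter X ?B \<subseteq> U_Inter X B'"
      by (auto simp: U_Inter_def)
    moreover have "connectedin X D" "D \<subseteq> U_Inter X ?B"
      using D by (auto simp: connected_components_of_subtopology_iff)
    moreover have "D \<inter> E \<noteq> {}"
      using D(2) CE C'(1) by blast
    ultimately show ?thesis
      using E by (auto simp: connected_components_of_subtopology_iff)
  qed
  ultimately show ?thesis using D(2) by blast
qed

lemma ubp_retract_Y: "ubp_retract (remove_point (U_space X) (min_open X a)) (U_space Y)"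
  unfolding U_space_def remove_point_down_set_topology
proof (rule ubp_retract_down_set_topology)
  show "finite (mxl_components X - {min_open X a})"
    using finite_mxl_components[OF finite_X] by simp
qed (use mxl_components_Y_subset exists_minimum_above_in_Y in auto)

end

subsection \<open>The case of a maximal \<open>b\<close>\<close>

context
  assumes b_mxl: "b \<in> mxl Y"
begin

lemma b_in_min_open_iff:
  assumes "c \<in> mxl X"
  shows "b \<in> min_open X c \<longleftrightarrow> c = a"
proof
  assume "b \<in> min_open X c"
  then have bc: "space_le X b c"
    using assms by (simp add: mxl_def mem_min_open_iff)
  show "c = a"
  proof (rule ccontr)
    assume "c \<noteq> a"
    then have "c = b"
      using bc b_neq_a mxlD[OF b_mxl] by (auto simp: space_le_remove_point)
    then show False
      using mxlD[OF assms] b_le_a b_neq_a by blast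
  qed
qed (use b_le_a a_in_X in \<open>simp add: mem_min_open_iff\<close>)

text \<open>
  A component of some \<open>U\<^sub>B\<close> other than \<open>U\<^sub>a\<close> has some \<open>c \<noteq> a\<close> in \<open>B\<close>. This keeps \<open>b\<close> out
  of it and permits the exchange of \<open>a\<close> for \<open>b\<close> in \<open>B\<close>. The next lemma is the same
  argument in the opposite direction.
\<close>

lemma mxl_component_cases:
  assumes "C \<in> mxl_components X"
  obtains "C = min_open X a" | "a \<notin> C" "b \<notin> C" "C \<in> mxl_components Y"
proof (cases "C = min_open X a")
  case False
  obtain B where B: "B \<noteq> {}" "B \<subseteq> mxl X"
      and C: "C \<in> connected_components_of (subtopology X (U_Inter X B))"
    using assms by (auto simp: mxl_components_iff)
  have "B \<noteq> {a}"
    using C False a_in_X by (auto simp: component_of_min_open_iff)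
  then obtain c where c: "c \<in> B" "c \<noteq> a" using B by blast
  then have "b \<notin> C"
    using b_in_min_open_iff[of c] B C
    by (auto simp: connected_components_of_subtopology_iff U_Inter_def)
  moreover have "\<exists>B'\<subseteq>mxl Y. B' \<noteq> {} \<and> U_Inter X B = U_Inter X B'"
  proof (cases "a \<in> B")
    case True
    then have "U_Inter X B = U_Inter X (insert b (B - {a}))"
      using U_Inter_insert_a[of "B - {a}"] c B mxl_subset_X by (auto simp: insert_absorb)
    moreover have "insert b (B - {a}) \<subseteq> mxl Y"
      using B mxl_Y_I b_mxl by blast
    ultimately show ?thesis by blast
  next
    case False
    then show ?thesis using B mxl_Y_I by blast
  qed
  then have "C \<in> mxl_components Y"
    using C by (auto simp: mxl_components_Y_iff)
  ultimately show ?thesis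
    using that mxl_component_Y_avoids_a by blast
qed (use that in blast)

lemma mxl_component_Y_cases:
  assumes "C \<in> mxl_components Y"
  obtains "C = min_open X b" | "a \<notin> C" "b \<notin> C" "C \<in> mxl_components X"
proof (cases "C = min_open X b")
  case False
  obtain B where B: "B \<noteq> {}" "B \<subseteq> mxl Y"
      and C: "C \<in> connected_components_of (subtopology X (U_Inter X B))"
    using assms by (auto simp: mxl_components_Y_iff)
  have "B \<noteq> {b}"
    using C False b_in_X by (auto simp: component_of_min_open_iff)
  then obtain c where c: "c \<in> B" "c \<noteq> b" using B by blast
  then have c': "c \<in> mxl X - {a}" using mxl_Y_D B by blast
  then have "b \<notin> C"
    using b_in_min_open_iff[of c] c C
    by (auto simp: connected_components_of_subtopology_iff U_Inter_def)
  moreover have "\<exists>B'\<subseteq>mxl X. B' \<noteq> {} \<and> U_Inter X B = U_Inter X B'"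
  proof (cases "b \<in> B")
    case True
    then have "U_Inter X B = U_Inter X (insert a (B - {b}))"
      using U_Inter_insert_a[of "B - {b}"] c B mxl_Y_subset by (auto simp: insert_absorb)
    moreover have "insert a (B - {b}) \<subseteq> mxl X"
      using B mxl_Y_D a_mxl by blast
    ultimately show ?thesis by blast
  next
    case False
    then show ?thesis using B mxl_Y_D by blast
  qed
  then have "C \<in> mxl_components X"
    using C by (auto simp: mxl_components_iff)
  ultimately show ?thesis
    using that mxl_component_Y_avoids_a assms by blast
qed (use that in blast)

lemma min_open_b_in_Y: "min_open X b \<in> mxl_components Y"
  unfolding mxl_components_Y_iff using b_mxl b_in_X
  by (intro exI[of _ "{b}"]) (simp add: component_of_min_open_iff)

lemma homeomorphic_U_space_Y: "U_space X homeomorphic_space U_space Y"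
  unfolding U_space_def
proof (rule homeomorphic_down_set_topology)
  \<comment> \<open>Membership of \<open>b\<close> singles out the one set to which \<open>a\<close> must be restored, and
    testing for it is visibly monotone.\<close>
  let ?f = "\<lambda>C. C - {a}" and ?g = "\<lambda>D. if b \<in> D then insert a D else D"
  have a_notin: "a \<notin> min_open X b"
    using a_in_min_open_iff[OF b_in_X] b_neq_a by blast
  show "?f C \<in> mxl_components Y" "?g (?f C) = C" if "C \<in> mxl_components X" for C
    using that a_notin min_open_b_in_Y b_in_min_open_b b_neq_a
    by (cases rule: mxl_component_cases; simp add: min_open_a)+
  show "?g D \<in> mxl_components X" "?f (?g D) = D" if "D \<in> mxl_components Y" for D
    using that a_notin min_open_a_in b_in_min_open_b
    by (cases rule: mxl_component_Y_cases; simp add: min_open_a)+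
qed (auto simp: mono_on_def)

end

end

theorem proposition6p8:
  fixes X :: "'a topology" and a b :: 'a
  assumes "finite (topspace X)" and "t0_space X"
    and "a \<in> mxl X" and "down_beat_point X a"
    and "is_maximum X (U_hat X a) b"
  shows "(b \<notin> mxl (remove_point X a) \<longrightarrow>
            down_beat_point (U_space X) (min_open X a) \<and>
            ubp_retract (remove_point (U_space X) (min_open X a)) (U_space (remove_point X a)))
       \<and> (b \<in> mxl (remove_point X a) \<longrightarrow>
            U_space X homeomorphic_space U_space (remove_point X a))"
proof -
  interpret maximal_down_beat_point X a b
    using assms by unfold_locales
  show ?thesis
    using down_beat_point_min_open_a ubp_retract_Y homeomorphic_U_space_Y by blast
qed

end
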